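(* For $\lambda\ge 0$ consider the boundary value problem $$r^2w''(r)-rw'(r)=\frac{\lambda}{2}r^4+\frac{w^2(r)}{2}\quad\text{for } r\in(0,1],\qquad \lim_{r\to 0_+}w'(r)=0,\qquad w(1)=w'(1). \qquad (N_\lambda)$$ There exists a real number $\lambda_0>0$ such that problem $(N_\lambda)$ is solvable for every $\lambda\in[0,\lambda_0)$ and there is no solution to problem $(N_\lambda)$ if $\lambda>\lambda_0$. Furthermore, for every $\lambda\ge 0$, every solution $w$ to $(N_\lambda)$ satisfies $$w(r)\le 0\quad\text{for } r\in(0,1],\qquad \lim_{r\to 0_+}w(r)=0.$$
   Context: A solution is a real-valued function $w:(0,1]\to\mathbb{R}$ which is of class $C^2$ on every compact interval $[a,b]\subseteq(0,1]$ (one-sided derivatives at the endpoint $r=1$), satisfies the differential equation for all $r\in(0,1]$ and satisfies the stated conditions. Under the substitution $t=r^2/2$, $u(t)=w(r)$ the problem is equivalent to $u''=\frac{u^2}{8t^2}+\frac{\lambda}{2}$ on $(0,1/2]$, $\lim_{t\to0_+}\sqrt{t}\,u'(t)=0$, $u(1/2)=u'(1/2)$. *)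

theory Defs
  imports "HOL-Analysis.Analysis"
begin

text \<open>
  The functions \<open>f'\<close> and \<open>f''\<close> are the first and second derivatives of \<open>f\<close> on \<open>S\<close>, and \<open>f\<close> is of
  class \<open>C\<close>-two there.  Derivatives are taken within \<open>S\<close>, hence are one-sided at the endpoints
  of an interval.
\<close>

definition C2_on :: "real set \<Rightarrow> (real \<Rightarrow> real) \<Rightarrow> (real \<Rightarrow> real) \<Rightarrow> (real \<Rightarrow> real) \<Rightarrow> bool" where
  "C2_on S f f' f'' \<longleftrightarrow>
     (\<forall>x\<in>S. (f has_real_derivative f' x) (at x within S)) \<and>
     (\<forall>x\<in>S. (f' has_real_derivative f'' x) (at x within S)) \<and>
     continuous_on S f''"

text \<open>
  A function \<open>w : (0,1] \<rightarrow> \<real>\<close> is represented by a total function of which only the values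
  on \<open>(0,1]\<close> matter.  The derivatives \<open>w'\<close> and \<open>w''\<close> are uniquely determined on \<open>(0,1]\<close>
  by the first conjunct, which concerns nondegenerate intervals only (at a degenerate one every
  number would be a derivative).
\<close>

definition N_solution :: "real \<Rightarrow> (real \<Rightarrow> real) \<Rightarrow> bool" where
  "N_solution lam w \<longleftrightarrow>
     (\<exists>w' w''.
        (\<forall>a b. 0 < a \<and> a < b \<and> b \<le> 1 \<longrightarrow> C2_on {a..b} w w' w'') \<and>
        (\<forall>r\<in>{0<..1}. r\<^sup>2 * w'' r - r * w' r = lam / 2 * r ^ 4 + (w r)\<^sup>2 / 2) \<and>
        (w' \<longlongrightarrow> 0) (at_right 0) \<and>
        w 1 = w' 1)"

end

theory Submission
  imports Defs "HOL-Real_Asymp.Real_Asymp"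
begin

text \<open>
  Put \<open>v = - w\<close> and \<open>q = v' / r\<close>.  The equation of second order becomes the system
  \<open>v' = r q\<close>, \<open>q' = - h / r\<^sup>2\<close> with \<open>h = \<lambda> r\<^sup>3 / 2 + v\<^sup>2 / (2 r)\<close>, and the condition at the
  endpoint becomes \<open>v 1 = q 1\<close>.  (In the variable \<open>t = r\<^sup>2 / 2\<close>, \<open>q\<close> is the derivative of \<open>v\<close>,
  so that \<open>h \<ge> 0\<close> means that \<open>v\<close> is concave.)

  If \<open>v\<close> did not tend to \<open>0\<close> at the origin, then the term \<open>v\<^sup>2 / r\<close> would produce a logarithmic
  singularity incompatible with \<open>r q \<rightarrow> 0\<close> (\<open>vanishes_at_origin\<close>).  So every solution vanishes at
  the origin, and for such functions the problem obeys a maximum principle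
  (\<open>boundary_pair_nonneg\<close>): \<open>h \<ge> 0\<close> implies \<open>v \<ge> 0\<close>.  This is the sign statement \<open>w \<le> 0\<close>, and it
  also makes the solution operator of the linear problem monotone in \<open>h\<close>.

  Since \<open>h\<close> increases with \<open>v \<ge> 0\<close>, Picard iteration from \<open>0\<close> increases; it stays below any upper
  solution \<open>V\<close>, and when \<open>V = O(r)\<close> all integrals are dominated, so the limit is a solution
  (\<open>decaying_solution_below_upper_solution\<close>).  The function \<open>V r = r\<close> is an upper solution for
  \<open>\<lambda> = 1\<close>, and a solution for \<open>\<mu>\<close> is one for every \<open>\<lambda> \<le> \<mu>\<close>.  Hence the solvable parameters form
  an interval that contains \<open>[0, 1]\<close>.  It is bounded: concavity gives \<open>v \<ge> A r\<^sup>2\<close> with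
  \<open>A = v 1\<close>, and integrating \<open>(v - r\<^sup>2 q / 2)' = h / 2\<close> over \<open>(0, 1]\<close> then yields
  \<open>\<lambda> \<le> 8 A - A\<^sup>2 \<le> 16\<close> (\<open>decaying_solution_parameter_bound\<close>).  The critical parameter is the
  supremum of the interval.
\<close>

section \<open>Functions on a half-open interval at the origin\<close>

lemma nonneg_derivative_imp_mono:
  fixes f :: "real \<Rightarrow> real"
  assumes der: "\<And>x. x \<in> {0<..b} \<Longrightarrow> (f has_real_derivative f' x) (at x within {0<..b})"
    and nonneg: "\<And>x. x \<in> {0<..b} \<Longrightarrow> 0 \<le> f' x"
    and "0 < s" "s \<le> t" "t \<le> b"
  shows "f s \<le> f t"
proof (rule DERIV_nonneg_imp_increasing_open [OF \<open>s \<le> t\<close>])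
  fix x assume x: "s < x" "x < t"
  have "at x within {0<..b} = at x"
    using x assms by (intro at_within_interior) auto
  then show "\<exists>y. DERIV f x :> y \<and> 0 \<le> y"
    using der[of x] nonneg[of x] x assms by auto
next
  have "continuous_on {0<..b} f"
    by (rule DERIV_continuous_on[OF der])
  then show "continuous_on {s..t} f"
    by (rule continuous_on_subset) (use assms in auto)
qed

lemma nonneg_derivative_imp_nonneg:
  fixes f :: "real \<Rightarrow> real"
  assumes der: "\<And>x. x \<in> {0<..b} \<Longrightarrow> (f has_real_derivative f' x) (at x within {0<..b})"
    and nonneg: "\<And>x. x \<in> {0<..b} \<Longrightarrow> 0 \<le> f' x"
    and lim: "(f \<longlongrightarrow> 0) (at_right 0)" and t: "t \<in> {0<..b}"
  shows "0 \<le> f t"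
proof (rule tendsto_upperbound [OF lim])
  have "eventually (\<lambda>s. s \<in> {0<..<t}) (at_right 0)"
    using t eventually_at_right_real[of 0 t] by simp
  then show "eventually (\<lambda>s. f s \<le> f t) (at_right 0)"
    by eventually_elim (use t in \<open>auto intro: nonneg_derivative_imp_mono [OF der nonneg]\<close>)
qed simp

lemma bounded_of_limit_at_right:
  fixes f :: "real \<Rightarrow> real"
  assumes cont: "continuous_on {0<..1} f" and lim: "(f \<longlongrightarrow> l) (at_right 0)"
  obtains C where "C > 0" "\<And>r. r \<in> {0<..1} \<Longrightarrow> \<bar>f r\<bar> \<le> C"
proof -
  have "eventually (\<lambda>r. dist (f r) l < 1) (at_right 0)"
    using lim by (rule tendstoD) simp
  then obtain d where d: "d > 0" "\<And>r. 0 < r \<Longrightarrow> r < d \<Longrightarrow> dist (f r) l < 1"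
    by (auto simp: eventually_at_right_field)
  have "compact (f ` {d..1})"
    using d by (intro compact_continuous_image continuous_on_subset[OF cont]) auto
  then obtain B where B: "\<And>r. r \<in> {d..1} \<Longrightarrow> \<bar>f r\<bar> \<le> B"
    by (force simp: bounded_iff dest!: compact_imp_bounded)
  show ?thesis
  proof (rule that[of "max 1 (max B (\<bar>l\<bar> + 1))"])
    show "\<bar>f r\<bar> \<le> max 1 (max B (\<bar>l\<bar> + 1))" if "r \<in> {0<..1}" for r
      using d(2)[of r] B[of r] that by (cases "r < d") (auto simp: dist_real_def)
  qed simp
qed

lemma continuous_on_closed_of_linear_bound:
  fixes f :: "real \<Rightarrow> real"
  assumes cont: "continuous_on {0<..1} f" and bound: "\<And>s. s \<in> {0..1} \<Longrightarrow> \<bar>f s\<bar> \<le> K * s"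
  shows "continuous_on {0..1} f"
proof -
  have f0: "f 0 = 0" using bound[of 0] by simp
  have "(f \<longlongrightarrow> 0) (at_right 0)"
  proof (rule Lim_null_comparison)
    have "eventually (\<lambda>s. s \<in> {0<..<1::real}) (at_right 0)"
      using eventually_at_right_real[of 0 "1::real"] by simp
    then show "eventually (\<lambda>s. norm (f s) \<le> K * s) (at_right 0)"
      by eventually_elim (use bound in auto)
    show "((\<lambda>s. K * s) \<longlongrightarrow> 0) (at_right 0)" by (auto intro!: tendsto_eq_intros)
  qed
  then have z: "continuous (at 0 within {0..1}) f"
    by (simp add: continuous_within f0 at_within_Icc_at_right)
  have "continuous (at x within {0..1}) f" if "x \<in> {0<..1}" for x
  proof -
    have "at x within {0..1} = at x within {0<..1}"
      by (rule at_within_nhd[of _ "{0<..}"]) (use that in auto)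
    then show ?thesis using cont that by (auto simp: continuous_on_eq_continuous_within)
  qed
  with z show ?thesis
    by (metis atLeastAtMost_iff continuous_on_eq_continuous_within greaterThanAtMost_iff less_eq_real_def)
qed

section \<open>The boundary condition and its maximum principle\<close>

text \<open>
  The linear problem with right-hand side \<open>h\<close>.  The condition \<open>r q \<rightarrow> 0\<close> is kept apart, so that
  functions such as \<open>v = r\<close>, \<open>q = 1 / r\<close> are available as upper solutions.
\<close>
definition boundary_pair :: "(real \<Rightarrow> real) \<Rightarrow> (real \<Rightarrow> real) \<Rightarrow> (real \<Rightarrow> real) \<Rightarrow> bool" where
  "boundary_pair h v q \<longleftrightarrow>
     (\<forall>r\<in>{0<..1}. (v has_real_derivative r * q r) (at r within {0<..1})) \<and>
     (\<forall>r\<in>{0<..1}. (q has_real_derivative - h r / r\<^sup>2) (at r within {0<..1})) \<and>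
     (v \<longlongrightarrow> 0) (at_right 0) \<and> v 1 = q 1"

lemma boundary_pairD:
  assumes "boundary_pair h v q"
  shows "\<And>r. r \<in> {0<..1} \<Longrightarrow> (v has_real_derivative r * q r) (at r within {0<..1})"
    and "\<And>r. r \<in> {0<..1} \<Longrightarrow> (q has_real_derivative - h r / r\<^sup>2) (at r within {0<..1})"
    and "(v \<longlongrightarrow> 0) (at_right 0)" "v 1 = q 1"
  using assms by (auto simp: boundary_pair_def)

lemma boundary_pair_continuous:
  assumes "boundary_pair h v q"
  shows "continuous_on {0<..1} v" "continuous_on {0<..1} q"
  by (rule DERIV_continuous_on, erule boundary_pairD[OF assms])+

text \<open>
  The maximum principle.  As \<open>q\<close> is nonincreasing, \<open>q \<ge> q 1\<close>, hence \<open>v \<ge> q 1 * r\<^sup>2 / 2\<close>.  At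
  \<open>r = 1\<close> the boundary condition turns this into \<open>q 1 \<ge> q 1 / 2\<close>, so \<open>q 1 \<ge> 0\<close>.
\<close>
lemma boundary_pair_nonneg:
  assumes bp: "boundary_pair h v q" and h: "\<And>r. r \<in> {0<..1} \<Longrightarrow> 0 \<le> h r"
    and r: "r \<in> {0<..1}"
  shows "0 \<le> q r" "0 \<le> v r"
proof -
  note D = boundary_pairD[OF bp]
  have anti: "q 1 \<le> q s" if "s \<in> {0<..1}" for s
  proof -
    have "- q s \<le> - q 1"
      by (rule nonneg_derivative_imp_mono[where b=1 and f'="\<lambda>r. h r / r\<^sup>2"])
         (use that h in \<open>auto intro!: derivative_eq_intros D(2)\<close>)
    then show ?thesis by simp
  qed
  have quad: "0 \<le> v s - q 1 * s\<^sup>2 / 2" if "s \<in> {0<..1}" for s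
    by (rule nonneg_derivative_imp_nonneg[where b=1 and f'="\<lambda>r. r * (q r - q 1)"])
       (use that anti in \<open>auto intro!: derivative_eq_intros tendsto_eq_intros D simp: algebra_simps\<close>)
  have q1: "0 \<le> q 1"
    using quad[of 1] D(4) by simp
  then show "0 \<le> q r" using anti[OF r] by simp
  show "0 \<le> v r" using quad[OF r] q1 by (smt (verit) mult_nonneg_nonneg zero_le_power2 divide_nonneg_nonneg)
qed

lemma boundary_pair_diff:
  assumes "boundary_pair h v q" "boundary_pair k u p"
  shows "boundary_pair (\<lambda>r. k r - h r) (\<lambda>r. u r - v r) (\<lambda>r. p r - q r)"
  unfolding boundary_pair_def
  using boundary_pairD(4)[OF assms(1)] boundary_pairD(4)[OF assms(2)]
  by (auto intro!: derivative_eq_intros tendsto_eq_intros boundary_pairD[OF assms(1)] boundary_pairD[OF assms(2)]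
      simp: field_simps)

lemma boundary_pair_mono:
  assumes "boundary_pair h v q" "boundary_pair k u p"
    and "\<And>r. r \<in> {0<..1} \<Longrightarrow> h r \<le> k r" and "r \<in> {0<..1}"
  shows "q r \<le> p r" "v r \<le> u r"
  using boundary_pair_nonneg[OF boundary_pair_diff[OF assms(1,2)] _ assms(4)] assms(3) by auto

section \<open>Green's operator\<close>

text \<open>
  Integrating \<open>q' = - h / r\<^sup>2\<close> from \<open>r\<close> to \<open>1\<close> leaves the constant \<open>q 1\<close>, which the boundary
  condition determines as the integral of \<open>h\<close>.
\<close>
definition green_slope :: "(real \<Rightarrow> real) \<Rightarrow> real \<Rightarrow> real" where
  "green_slope h r = integral {0..1} h + integral {r..1} (\<lambda>s. h s / s\<^sup>2)"

text \<open>
  The primitive of \<open>r * green_slope h r\<close> that vanishes at \<open>0\<close>, after an integration by parts.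
  It is the integral of \<open>(r\<^sup>2 + (min r s)\<^sup>2 / s\<^sup>2) / 2\<close> against \<open>h s\<close>.
\<close>
definition green :: "(real \<Rightarrow> real) \<Rightarrow> real \<Rightarrow> real" where
  "green h r = r\<^sup>2 / 2 * green_slope h r + integral {0..r} h / 2"

lemma has_derivative_half_openI:
  assumes "\<And>a. 0 < a \<Longrightarrow> a < r \<Longrightarrow> (f has_real_derivative D) (at r within {a..1})"
    and r: "r \<in> {0<..1}"
  shows "(f has_real_derivative D) (at r within {0<..1})"
proof -
  have "at r within {r/2..1} = at r within {0<..1}"
    by (rule at_within_nhd[of _ "{r/2<..}"]) (use r in auto)
  then show ?thesis using assms(1)[of "r/2"] r by auto
qed

text \<open>
  A linear bound on \<open>h\<close> makes the slope at most logarithmic at the origin.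
\<close>
lemma green_slope_vanishes:
  assumes cont: "continuous_on {0..1} h" and bound: "\<And>s. s \<in> {0..1} \<Longrightarrow> \<bar>h s\<bar> \<le> K * s"
  shows "((\<lambda>r. r * green_slope h r) \<longlongrightarrow> 0) (at_right 0)"
proof (rule Lim_null_comparison)
  define H where "H = \<bar>integral {0..1} h\<bar>"
  have "\<bar>r * green_slope h r\<bar> \<le> r * (H + K * (- ln r))" if r: "r \<in> {0<..<1}" for r
  proof -
    have log: "((\<lambda>s. K / s) has_integral (K * ln 1 - K * ln r)) {r..1}"
      by (rule fundamental_theorem_of_calculus)
         (use r in \<open>auto intro!: derivative_eq_intros simp: has_real_derivative_iff_has_vector_derivative[symmetric]\<close>)
    have "norm (integral {r..1} (\<lambda>s. h s / s\<^sup>2)) \<le> integral {r..1} (\<lambda>s. K / s)"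
    proof (rule integral_norm_bound_integral)
      show "(\<lambda>s. h s / s\<^sup>2) integrable_on {r..1}"
        using r by (intro integrable_continuous_real continuous_intros continuous_on_subset[OF cont]) auto
      show "norm (h s / s\<^sup>2) \<le> K / s" if "s \<in> {r..1}" for s
        using bound[of s] that r by (simp add: field_simps power2_eq_square)
    qed (use log in blast)
    then have "\<bar>integral {r..1} (\<lambda>s. h s / s\<^sup>2)\<bar> \<le> K * (- ln r)"
      using integral_unique[OF log] by simp
    then have "\<bar>green_slope h r\<bar> \<le> H + K * (- ln r)"
      unfolding green_slope_def H_def by linarith
    then show ?thesis using r by (simp add: abs_mult mult_left_mono)
  qed
  moreover have "eventually (\<lambda>r. r \<in> {0<..<1::real}) (at_right 0)"
    using eventually_at_right_real[of 0 "1::real"] by simp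
  ultimately show "eventually (\<lambda>r. norm (r * green_slope h r) \<le> r * (H + K * (- ln r))) (at_right 0)"
    by (auto elim: eventually_mono)
  show "((\<lambda>r. r * (H + K * (- ln r))) \<longlongrightarrow> 0) (at_right 0)" by real_asymp
qed

lemma green_boundary_pair:
  assumes cont: "continuous_on {0..1} h" and bound: "\<And>s. s \<in> {0..1} \<Longrightarrow> \<bar>h s\<bar> \<le> K * s"
  shows "boundary_pair h (green h) (green_slope h)"
  unfolding boundary_pair_def
proof (intro conjI ballI)
  have slope: "(green_slope h has_real_derivative - h r / r\<^sup>2) (at r within {0<..1})"
    if r: "r \<in> {0<..1}" for r
  proof (rule has_derivative_half_openI[OF _ r])
    fix a assume a: "0 < a" "a < r"
    have "continuous_on {a..1} (\<lambda>s. h s / s\<^sup>2)"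
      using a by (intro continuous_intros continuous_on_subset[OF cont]) auto
    then show "(green_slope h has_real_derivative - h r / r\<^sup>2) (at r within {a..1})"
      unfolding green_slope_def
      using r a by (auto intro!: derivative_eq_intros integral_has_real_derivative')
  qed
  show "(green_slope h has_real_derivative - h r / r\<^sup>2) (at r within {0<..1})"
    if "r \<in> {0<..1}" for r by (rule slope[OF that])
  show "(green h has_real_derivative r * green_slope h r) (at r within {0<..1})"
    if r: "r \<in> {0<..1}" for r
  proof -
    have "((\<lambda>r. integral {0..r} h) has_real_derivative h r) (at r within {0<..1})"
      using integral_has_real_derivative[OF cont, of r] r
      by (auto elim: DERIV_subset)
    then show ?thesis unfolding green_def
      using r by (auto intro!: derivative_eq_intros slope simp: field_simps)
  qed
  have "continuous_on {0..1} (\<lambda>r. integral {0..r} h)"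
    by (intro indefinite_integral_continuous_1 integrable_continuous_real cont)
  then have "((\<lambda>r. integral {0..r} h) \<longlongrightarrow> 0) (at_right 0)"
    by (auto simp: continuous_on_def at_within_Icc_at_right dest: bspec[of _ _ 0])
  then have "((\<lambda>r. r / 2 * (r * green_slope h r) + integral {0..r} h / 2) \<longlongrightarrow> 0 / 2 * 0 + 0 / 2) (at_right 0)"
    by (intro tendsto_intros green_slope_vanishes[OF cont bound]) auto
  then show "(green h \<longlongrightarrow> 0) (at_right 0)"
    unfolding green_def by (simp add: power2_eq_square mult.assoc)
  show "green h 1 = green_slope h 1"
    by (simp add: green_def green_slope_def)
qed


section \<open>The quadratic source term\<close>

definition source :: "real \<Rightarrow> (real \<Rightarrow> real) \<Rightarrow> real \<Rightarrow> real" where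
  "source lam v r = lam * r ^ 3 / 2 + (v r)\<^sup>2 / (2 * r)"

lemma source_nonneg: "0 \<le> lam \<Longrightarrow> 0 \<le> r \<Longrightarrow> 0 \<le> source lam v r"
  by (simp add: source_def)

lemma source_mono:
  assumes "lam \<le> mu" "0 \<le> r" "0 \<le> v r" "v r \<le> u r"
  shows "source lam v r \<le> source mu u r"
  unfolding source_def
  using assms by (intro add_mono divide_right_mono mult_right_mono power_mono) auto

lemma source_linear_bound:
  assumes "0 \<le> lam" "r \<in> {0..1}" "r > 0 \<Longrightarrow> 0 \<le> v r \<and> v r \<le> C * r"
  shows "\<bar>source lam v r\<bar> \<le> (lam / 2 + C\<^sup>2 / 2) * r"
proof (cases "r = 0")
  case False
  then have r: "0 < r" "r \<le> 1" using assms(2) by auto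
  have "r ^ 3 \<le> r ^ 1" using r by (intro power_decreasing) auto
  then have "lam * r ^ 3 \<le> lam * r" using assms(1) by (intro mult_left_mono) auto
  moreover have "(v r)\<^sup>2 \<le> (C * r)\<^sup>2" using assms(3) r by (intro power_mono) auto
  then have "(v r)\<^sup>2 / (2 * r) \<le> (C * r)\<^sup>2 / (2 * r)" using r by (intro divide_right_mono) auto
  moreover have "(C * r)\<^sup>2 / (2 * r) = C\<^sup>2 / 2 * r" using r by (simp add: field_simps power2_eq_square)
  ultimately have "source lam v r \<le> (lam / 2 + C\<^sup>2 / 2) * r"
    by (simp add: source_def algebra_simps)
  then show ?thesis using source_nonneg[of lam r v] assms(1) r by simp
qed (simp add: source_def)

lemma source_continuous_on:
  assumes "continuous_on {0<..1} v"
  shows "continuous_on {0<..1} (source lam v)"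
  unfolding source_def by (intro continuous_intros assms) auto

text \<open>
  Since \<open>v' = r q\<close> is bounded, \<open>v\<close> has a limit \<open>L\<close>.  The function \<open>F = v - r\<^sup>2 q / 2\<close> has the
  same limit, and \<open>F' = h / 2 \<ge> v\<^sup>2 / (4 r)\<close>.  If \<open>L \<noteq> 0\<close>, then \<open>F'\<close> is at least a positive
  multiple of \<open>1 / r\<close> near \<open>0\<close>, which would force \<open>F\<close> to tend to minus infinity.
\<close>
lemma vanishes_at_origin:
  assumes lam: "0 \<le> lam"
    and v: "\<And>r. r \<in> {0<..1} \<Longrightarrow> (v has_real_derivative r * q r) (at r within {0<..1})"
    and q: "\<And>r. r \<in> {0<..1} \<Longrightarrow> (q has_real_derivative - source lam v r / r\<^sup>2) (at r within {0<..1})"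
    and lim: "((\<lambda>r. r * q r) \<longlongrightarrow> 0) (at_right 0)"
  shows "(v \<longlongrightarrow> 0) (at_right 0)"
proof -
  have "continuous_on {0<..1} (\<lambda>r. r * q r)"
    by (intro continuous_intros DERIV_continuous_on[OF q])
  from bounded_of_limit_at_right[OF this lim]
  obtain C where C: "C > 0" "\<And>r. r \<in> {0<..1} \<Longrightarrow> \<bar>r * q r\<bar> \<le> C" by blast
  have "C-lipschitz_on {0<..1} v"
  proof (rule bounded_derivative_imp_lipschitz)
    show "(v has_derivative (*) (r * q r)) (at r within {0<..1})" if "r \<in> {0<..1}" for r
      using v[OF that] by (simp add: has_field_derivative_def)
    show "onorm ((*) (r * q r)) \<le> C" if "r \<in> {0<..1}" for r
      using C(2)[OF that] by (intro onorm_le) (auto simp: abs_mult intro!: mult_right_mono)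
  qed (use C in auto)
  then have "uniformly_continuous_on {0<..1} v" by (rule lipschitz_on_uniformly_continuous)
  moreover have "(0::real) \<in> closure {0<..1}" by simp
  ultimately obtain L where "(v \<longlongrightarrow> L) (at 0 within {0<..1})"
    by (rule uniformly_continuous_on_extension_at_closure)
  moreover have "at 0 within {0<..1} = at_right (0::real)"
    by (rule at_within_nhd[of _ "{..<1}"]) auto
  ultimately have vL: "(v \<longlongrightarrow> L) (at_right 0)" by simp
  define F where "F r = v r - r\<^sup>2 * q r / 2" for r
  have dF: "(F has_real_derivative source lam v r / 2) (at r within {0<..1})" if "r \<in> {0<..1}" for r
    unfolding F_def using that
    by (auto intro!: derivative_eq_intros v q simp: field_simps power2_eq_square)
  have "((\<lambda>r. v r - r / 2 * (r * q r)) \<longlongrightarrow> L - 0 / 2 * 0) (at_right 0)"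
    by (intro tendsto_intros vL lim) auto
  then have FL: "(F \<longlongrightarrow> L) (at_right 0)"
    unfolding F_def by (simp add: power2_eq_square mult.assoc)
  have "L = 0"
  proof (rule ccontr)
    assume "L \<noteq> 0"
    \<comment> \<open>Near \<open>0\<close> one has \<open>v\<^sup>2 > L\<^sup>2 / 2\<close>, hence \<open>F' \<ge> c / r\<close>.\<close>
    define c where "c = L\<^sup>2 / 8"
    have c: "c > 0" using \<open>L \<noteq> 0\<close> by (simp add: c_def)
    have "((\<lambda>r. (v r)\<^sup>2) \<longlongrightarrow> L\<^sup>2) (at_right 0)" by (intro tendsto_intros vL)
    then have "eventually (\<lambda>r. L\<^sup>2 / 2 < (v r)\<^sup>2) (at_right 0)"
      by (rule order_tendstoD) (use \<open>L \<noteq> 0\<close> in auto)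
    then obtain d where d: "d > 0" "\<And>r. 0 < r \<Longrightarrow> r < d \<Longrightarrow> L\<^sup>2 / 2 < (v r)\<^sup>2"
      by (auto simp: eventually_at_right_field)
    define b where "b = min (d/2) 1"
    have b: "0 < b" "b < d" "b \<le> 1" using d by (auto simp: b_def)
    have le: "F s \<le> F b - c * ln b + c * ln s" if s: "s \<in> {0<..<b}" for s
    proof -
      have "F s - c * ln s \<le> F b - c * ln b"
      proof (rule nonneg_derivative_imp_mono[where b=b and f="\<lambda>r. F r - c * ln r" and f'="\<lambda>r. source lam v r / 2 - c / r"])
        fix x assume x: "x \<in> {0<..b}"
        then have "(F has_real_derivative source lam v x / 2) (at x within {0<..b})"
          using b by (intro DERIV_subset[OF dF]) auto
        then show "((\<lambda>r. F r - c * ln r) has_real_derivative source lam v x / 2 - c / x) (at x within {0<..b})"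
          using x by (auto intro!: derivative_eq_intros)
        have "L\<^sup>2 / 2 / (4 * x) \<le> (v x)\<^sup>2 / (4 * x)"
          using d(2)[of x] x b by (intro divide_right_mono) auto
        moreover have "c / x = L\<^sup>2 / 2 / (4 * x)" by (simp add: c_def)
        moreover have "source lam v x / 2 = lam * x ^ 3 / 4 + (v x)\<^sup>2 / (4 * x)"
          by (simp add: source_def add_divide_distrib)
        moreover have "0 \<le> lam * x ^ 3 / 4" using lam x by simp
        ultimately show "0 \<le> source lam v x / 2 - c / x" by linarith
      qed (use s in auto)
      then show ?thesis by simp
    qed
    have "filterlim (\<lambda>s. F b - c * ln b + c * ln s) at_bot (at_right 0)"
      using c by real_asymp
    moreover have "eventually (\<lambda>s. s \<in> {0<..<b}) (at_right 0)"
      using b eventually_at_right_real[of 0 b] by simp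
    then have "eventually (\<lambda>s. F s \<le> F b - c * ln b + c * ln s) (at_right 0)"
      by eventually_elim (rule le)
    ultimately have "filterlim F at_bot (at_right 0)" by (rule filterlim_at_bot_mono)
    then show False using FL not_tendsto_and_filterlim_at_infinity[of "at_right (0::real)" F L]
      by (auto intro: filterlim_at_bot_imp_at_infinity)
  qed
  then show ?thesis using vL by simp
qed

section \<open>Reformulation of the boundary value problem\<close>

definition decaying_solution :: "real \<Rightarrow> (real \<Rightarrow> real) \<Rightarrow> (real \<Rightarrow> real) \<Rightarrow> bool" where
  "decaying_solution lam v q \<longleftrightarrow>
     boundary_pair (source lam v) v q \<and> ((\<lambda>r. r * q r) \<longlongrightarrow> 0) (at_right 0)"

lemma N_solution_imp_decaying_solution:
  assumes lam: "0 \<le> lam" and N: "N_solution lam w"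
  shows "\<exists>q. decaying_solution lam (\<lambda>r. - w r) q"
proof -
  obtain w' w'' where
    C2: "\<And>a b. 0 < a \<Longrightarrow> a < b \<Longrightarrow> b \<le> 1 \<Longrightarrow> C2_on {a..b} w w' w''"
    and ode: "\<And>r. r \<in> {0<..1} \<Longrightarrow> r\<^sup>2 * w'' r - r * w' r = lam / 2 * r ^ 4 + (w r)\<^sup>2 / 2"
    and lim: "(w' \<longlongrightarrow> 0) (at_right 0)" and w1: "w 1 = w' 1"
    using N unfolding N_solution_def by blast
  have dw: "(w has_real_derivative w' r) (at r within {0<..1})"
    and dw': "(w' has_real_derivative w'' r) (at r within {0<..1})" if r: "r \<in> {0<..1}" for r
    using C2[of _ 1] r
    by (auto simp: C2_on_def intro!: has_derivative_half_openI)
  define v where "v = (\<lambda>r. - w r)"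
  define q where "q r = - w' r / r" for r
  have v: "(v has_real_derivative r * q r) (at r within {0<..1})" if "r \<in> {0<..1}" for r
    unfolding v_def using that by (auto intro!: derivative_eq_intros dw simp: q_def)
  have q: "(q has_real_derivative - source lam v r / r\<^sup>2) (at r within {0<..1})"
    if r: "r \<in> {0<..1}" for r
  proof -
    have "r * source lam v r = r * (r * w'' r - w' r)"
      using r ode[OF r] by (simp add: source_def v_def field_simps power_numeral_reduce)
    then have "source lam v r = r * w'' r - w' r" using r by simp
    then show ?thesis
      unfolding q_def using r
      by (auto intro!: derivative_eq_intros dw' simp: field_simps power2_eq_square)
  qed
  have "((\<lambda>r. - w' r) \<longlongrightarrow> 0) (at_right 0)" using tendsto_minus[OF lim] by simp
  then have rq: "((\<lambda>r. r * q r) \<longlongrightarrow> 0) (at_right 0)"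
    by (rule Lim_transform_eventually)
       (auto simp: q_def eventually_at_right_field intro!: exI[of _ 1])
  have "decaying_solution lam v q"
    unfolding decaying_solution_def boundary_pair_def
    using v q rq vanishes_at_origin[OF lam v q rq] w1 by (auto simp: v_def q_def)
  then show ?thesis unfolding v_def by blast
qed

lemma decaying_solution_imp_N_solution:
  assumes D: "decaying_solution lam v q"
  shows "N_solution lam (\<lambda>r. - v r)"
proof -
  have bp: "boundary_pair (source lam v) v q"
    and lim: "((\<lambda>r. r * q r) \<longlongrightarrow> 0) (at_right 0)"
    using D by (auto simp: decaying_solution_def)
  note B = boundary_pairD[OF bp]
  define w' where "w' r = - (r * q r)" for r
  define w'' where "w'' r = source lam v r / r - q r" for r
  have d1: "((\<lambda>r. - v r) has_real_derivative w' r) (at r within {0<..1})"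
    and d2: "(w' has_real_derivative w'' r) (at r within {0<..1})" if "r \<in> {0<..1}" for r
    unfolding w'_def w''_def using that
    by (auto intro!: derivative_eq_intros B simp: field_simps power2_eq_square)
  have "continuous_on {0<..1} w''"
    unfolding w''_def
    by (intro continuous_intros source_continuous_on boundary_pair_continuous[OF bp]) auto
  then have "C2_on {a..b} (\<lambda>r. - v r) w' w''" if "0 < a" "a < b" "b \<le> 1" for a b
    unfolding C2_on_def using that
    by (auto intro!: DERIV_subset[OF d1] DERIV_subset[OF d2] elim!: continuous_on_subset)
  moreover have "r\<^sup>2 * w'' r - r * w' r = lam / 2 * r ^ 4 + (- v r)\<^sup>2 / 2" if "r \<in> {0<..1}" for r
    using that by (simp add: w'_def w''_def source_def field_simps power_numeral_reduce)
  moreover have "(w' \<longlongrightarrow> 0) (at_right 0)"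
    unfolding w'_def using tendsto_minus[OF lim] by simp
  ultimately show ?thesis
    unfolding N_solution_def using B(4) by (intro exI[of _ w'] exI[of _ w'']) (auto simp: w'_def)
qed

section \<open>Monotone iteration below an upper solution\<close>

text \<open>
  The iterates \<open>u n\<close> start at \<open>0\<close>, increase, and stay below \<open>V\<close>, all by comparison for the linear
  problem.  Comparison also holds for the slopes, so both \<open>u n\<close> and \<open>V - u n\<close> are nondecreasing
  in \<open>r\<close>; hence \<open>V\<close> provides a common modulus of continuity, and the pointwise limit is continuous.
  The linear bound on \<open>V\<close> dominates the source terms, so that the limit passes through the integrals.
\<close>
lemma decaying_solution_below_upper_solution:
  assumes lam: "0 \<le> lam" and bp: "boundary_pair G V Q"
    and upper: "\<And>r. r \<in> {0<..1} \<Longrightarrow> source lam V r \<le> G r"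
    and linear: "\<And>r. r \<in> {0<..1} \<Longrightarrow> V r \<le> C * r"
  shows "\<exists>v q. decaying_solution lam v q"
proof -
  \<comment> \<open>The order interval between \<open>0\<close> and \<open>V\<close>, which the iteration maps to itself.\<close>
  define good where
    "good v \<longleftrightarrow> continuous_on {0<..1} v \<and> (\<forall>r\<in>{0<..1}. 0 \<le> v r \<and> v r \<le> V r)" for v :: "real \<Rightarrow> real"
  define step where "step v = green (source lam v)" for v
  define K where "K = lam / 2 + C\<^sup>2 / 2"
  have V0: "0 \<le> V r" if "r \<in> {0<..1}" for r
    by (rule boundary_pair_nonneg(2)[OF bp order_trans[OF source_nonneg[OF lam] upper] that]) auto
  have bound: "\<bar>source lam v s\<bar> \<le> K * s" if "good v" "s \<in> {0..1}" for v s
    unfolding K_def using that lam linear[of s]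
    by (intro source_linear_bound) (force simp: good_def)+
  have cont: "continuous_on {0..1} (source lam v)" if "good v" for v
    using that bound[OF that] source_continuous_on[of v lam]
    by (intro continuous_on_closed_of_linear_bound[of _ K]) (auto simp: good_def)
  have pair: "boundary_pair (source lam v) (step v) (green_slope (source lam v))" if "good v" for v
    unfolding step_def by (rule green_boundary_pair[OF cont[OF that] bound[OF that]])
  have below: "source lam v r \<le> G r" if "good v" "r \<in> {0<..1}" for v r
    using that upper[of r] source_mono[of lam lam r v V] by (force simp: good_def)
  have pos: "0 \<le> source lam v r" if "r \<in> {0<..1}" for v r
    using source_nonneg[OF lam] that by simp
  have good_step: "good (step v)" if g: "good v" for v
    unfolding good_def
    using boundary_pair_continuous(1)[OF pair[OF g]] boundary_pair_nonneg(2)[OF pair[OF g] pos]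
      boundary_pair_mono(2)[OF pair[OF g] bp below[OF g]] by blast
  have modulus: "\<bar>step v t - step v s\<bar> \<le> \<bar>V t - V s\<bar>"
    if g: "good v" and s: "s \<in> {0<..1}" and t: "t \<in> {0<..1}" for v s t
  proof -
    have "step v s \<le> step v t \<and> V s - step v s \<le> V t - step v t"
      if "0 < s" "s \<le> t" "t \<le> 1" for s t
    proof
      show "step v s \<le> step v t"
        by (rule nonneg_derivative_imp_mono[OF boundary_pairD(1)[OF pair[OF g]]])
           (use that boundary_pair_nonneg(1)[OF pair[OF g] pos] in auto)
      show "V s - step v s \<le> V t - step v t"
        by (rule nonneg_derivative_imp_mono[OF boundary_pairD(1)[OF boundary_pair_diff[OF pair[OF g] bp]]])
           (use that boundary_pair_mono(1)[OF pair[OF g] bp below[OF g]] in auto)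
    qed
    from this[of s t] this[of t s] s t show ?thesis by (cases "s \<le> t") auto
  qed
  define u where "u n = (step ^^ n) (\<lambda>_. 0)" for n
  have u_Suc: "u (Suc n) = step (u n)" for n by (simp add: u_def)
  have u0: "u 0 = (\<lambda>_. 0)" by (simp add: u_def)
  have gu: "good (u n)" for n
  proof (induction n)
    case 0
    show ?case by (auto simp: u0 good_def V0)
  next
    case (Suc n)
    then show ?case unfolding u_Suc by (rule good_step)
  qed
  have mono: "u n r \<le> u (Suc n) r" if "r \<in> {0<..1}" for n r
    using that
  proof (induction n arbitrary: r)
    case 0
    then show ?case using gu[of 1] by (auto simp: good_def u0)
  next
    case (Suc n)
    have "source lam (u n) s \<le> source lam (u (Suc n)) s" if "s \<in> {0<..1}" for s
      using Suc.IH[OF that] gu[of n] that by (intro source_mono) (auto simp: good_def)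
    from boundary_pair_mono(2)[OF pair[OF gu] pair[OF gu] this Suc.prems]
    show ?case by (simp add: u_Suc)
  qed
  have "\<exists>l. (\<lambda>n. u n r) \<longlonglongrightarrow> l" if r: "r \<in> {0<..1}" for r
  proof -
    have "incseq (\<lambda>n. u n r)" using mono[OF r] by (rule incseq_SucI)
    moreover have "\<forall>n. u n r \<le> V r" using gu r by (auto simp: good_def)
    ultimately show ?thesis by (metis incseq_convergent)
  qed
  then obtain L where L: "\<And>r. r \<in> {0<..1} \<Longrightarrow> (\<lambda>n. u n r) \<longlonglongrightarrow> L r" by metis
  have Lmod: "\<bar>L t - L s\<bar> \<le> \<bar>V t - V s\<bar>" if "s \<in> {0<..1}" "t \<in> {0<..1}" for s t
  proof (rule tendsto_upperbound)
    show "(\<lambda>n. \<bar>u (Suc n) t - u (Suc n) s\<bar>) \<longlonglongrightarrow> \<bar>L t - L s\<bar>"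
      by (intro tendsto_intros LIMSEQ_Suc L that)
    show "eventually (\<lambda>n. \<bar>u (Suc n) t - u (Suc n) s\<bar> \<le> \<bar>V t - V s\<bar>) sequentially"
      using modulus[OF gu that] by (simp add: u_Suc)
  qed simp
  have "continuous_on {0<..1} L"
    using boundary_pair_continuous(1)[OF bp] Lmod
    unfolding continuous_on_iff dist_real_def by (meson le_less_trans)
  moreover have "0 \<le> L r \<and> L r \<le> V r" if "r \<in> {0<..1}" for r
    using gu that LIMSEQ_le_const[OF L[OF that], of 0] LIMSEQ_le_const2[OF L[OF that], of "V r"]
    by (auto simp: good_def)
  ultimately have gL: "good L" by (auto simp: good_def)
  have conv: "(\<lambda>n. source lam (u n) s) \<longlonglongrightarrow> source lam L s" if "s \<in> {0..1}" for s
  proof (cases "s = 0")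
    case False
    then show ?thesis unfolding source_def using that by (intro tendsto_intros L) auto
  qed (simp add: source_def)
  have fixpoint: "L r = step L r" if r: "r \<in> {0<..1}" for r
  proof -
    have sub: "(\<lambda>n. integral {0..b} (source lam (u n))) \<longlonglongrightarrow> integral {0..b} (source lam L)"
      if b: "b \<in> {0..1}" for b
    proof (rule dominated_convergence(2)[where h="\<lambda>s. K * s"])
      show "source lam (u k) integrable_on {0..b}" for k
        using b by (intro integrable_continuous_real continuous_on_subset[OF cont[OF gu]]) auto
      show "(\<lambda>s. K * s) integrable_on {0..b}"
        by (intro integrable_continuous_real continuous_intros)
    qed (use b bound[OF gu] conv in auto)
    have "(\<lambda>n. integral {r..1} (\<lambda>s. source lam (u n) s / s\<^sup>2)) \<longlonglongrightarrow> integral {r..1} (\<lambda>s. source lam L s / s\<^sup>2)"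
    proof (rule dominated_convergence(2)[where h="\<lambda>s. K * s / s\<^sup>2"])
      show "(\<lambda>s. source lam (u k) s / s\<^sup>2) integrable_on {r..1}" for k
        using r by (intro integrable_continuous_real continuous_intros continuous_on_subset[OF cont[OF gu]]) auto
      show "(\<lambda>s. K * s / s\<^sup>2) integrable_on {r..1}"
        using r by (intro integrable_continuous_real continuous_intros) auto
      show "norm (source lam (u k) s / s\<^sup>2) \<le> K * s / s\<^sup>2" if "s \<in> {r..1}" for k s
        using bound[OF gu, of s k] that r by (auto simp: abs_divide intro: divide_right_mono)
      show "(\<lambda>k. source lam (u k) s / s\<^sup>2) \<longlonglongrightarrow> source lam L s / s\<^sup>2" if "s \<in> {r..1}" for s
        using that r by (intro tendsto_intros conv) auto
    qed
    then have "(\<lambda>n. step (u n) r) \<longlonglongrightarrow> step L r"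
      unfolding step_def green_def green_slope_def
      using r by (intro tendsto_intros sub) auto
    then show ?thesis
      using LIMSEQ_unique[OF LIMSEQ_Suc[OF L[OF r]]] by (simp add: u_Suc)
  qed
  \<comment> \<open>\<open>L\<close> is determined on \<open>(0, 1]\<close> only, so the solution is represented by \<open>step L\<close>.\<close>
  have "source lam (step L) r = source lam L r" if "r \<in> {0<..1}" for r
    using fixpoint[OF that] by (simp add: source_def)
  then have "decaying_solution lam (step L) (green_slope (source lam L))"
    using pair[OF gL] green_slope_vanishes[OF cont[OF gL] bound[OF gL]]
    by (simp add: decaying_solution_def boundary_pair_def)
  then show ?thesis by blast
qed

section \<open>The solvable parameters form a bounded interval\<close>

text \<open>
  The derivative \<open>r q\<close> is bounded because it is continuous and tends to \<open>0\<close>.  This is the bound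
  that allows a solution to serve as an upper solution.
\<close>
lemma decaying_solution_linear_bound:
  assumes "decaying_solution lam v q"
  shows "\<exists>C. \<forall>r\<in>{0<..1}. v r \<le> C * r"
proof -
  have bp: "boundary_pair (source lam v) v q"
    and lim: "((\<lambda>r. r * q r) \<longlongrightarrow> 0) (at_right 0)"
    using assms by (auto simp: decaying_solution_def)
  note B = boundary_pairD[OF bp]
  have "continuous_on {0<..1} (\<lambda>r. r * q r)"
    by (intro continuous_intros boundary_pair_continuous[OF bp])
  from bounded_of_limit_at_right[OF this lim]
  obtain C where C: "\<And>r. r \<in> {0<..1} \<Longrightarrow> \<bar>r * q r\<bar> \<le> C" by blast
  have "0 \<le> C * r - v r" if "r \<in> {0<..1}" for r
    by (rule nonneg_derivative_imp_nonneg[where b=1 and f'="\<lambda>r. C - r * q r"])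
       (use that C in \<open>auto intro!: derivative_eq_intros tendsto_eq_intros B simp: abs_le_iff\<close>)
  then show ?thesis by (auto intro!: exI[of _ C])
qed

lemma decaying_solution_smaller_parameter:
  assumes "0 \<le> lam" "lam \<le> mu" "decaying_solution mu V Q"
  shows "\<exists>v q. decaying_solution lam v q"
proof -
  obtain C where "\<forall>r\<in>{0<..1}. V r \<le> C * r"
    using decaying_solution_linear_bound[OF assms(3)] by blast
  moreover have "source lam V r \<le> source mu V r" if "r \<in> {0<..1}" for r
    using that assms(2) by (auto simp: source_def intro!: mult_right_mono)
  ultimately show ?thesis
    using assms by (intro decaying_solution_below_upper_solution[of lam "source mu V" V Q C])
      (auto simp: decaying_solution_def)
qed

text \<open>
  The function \<open>V r = r\<close> satisfies the boundary condition with slope \<open>1 / r\<close>, whose derivative is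
  \<open>- 1 / r\<^sup>2\<close>; its source term \<open>(r\<^sup>3 + r) / 2\<close> for the parameter \<open>1\<close> is at most \<open>1\<close>.
\<close>
lemma decaying_solution_exists_one: "\<exists>v q. decaying_solution 1 v q"
proof (rule decaying_solution_below_upper_solution)
  show "boundary_pair (\<lambda>r. 1) (\<lambda>r. r) (\<lambda>r. 1 / r)"
    unfolding boundary_pair_def
    by (auto intro!: derivative_eq_intros tendsto_eq_intros simp: power2_eq_square)
  show "source 1 (\<lambda>r. r) r \<le> 1" if "r \<in> {0<..1}" for r
    using source_linear_bound[of 1 r "\<lambda>r. r" 1] that by auto
qed auto

text \<open>
  Again \<open>F = v - r\<^sup>2 q / 2\<close> satisfies \<open>F' = h / 2\<close>, now with \<open>F \<rightarrow> 0\<close>, so \<open>F \<ge> 0\<close>.  As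
  \<open>(v / r\<^sup>2)' = - 2 F / r\<^sup>3\<close>, this gives \<open>v \<ge> A r\<^sup>2\<close> with \<open>A = v 1\<close>, and then
  \<open>F' \<ge> (\<lambda> + A\<^sup>2) r\<^sup>3 / 4\<close>.  Since \<open>F 1 = A / 2\<close>, integration yields \<open>\<lambda> + A\<^sup>2 \<le> 8 A\<close>.
\<close>
lemma decaying_solution_parameter_bound:
  assumes lam: "0 \<le> lam" and D: "decaying_solution lam v q"
  shows "lam \<le> 16"
proof -
  have bp: "boundary_pair (source lam v) v q"
    and lim: "((\<lambda>r. r * q r) \<longlongrightarrow> 0) (at_right 0)"
    using D by (auto simp: decaying_solution_def)
  note B = boundary_pairD[OF bp]
  have src: "0 \<le> source lam v r" if "r \<in> {0<..1}" for r
    using source_nonneg[OF lam] that by simp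
  define F where "F r = v r - r\<^sup>2 * q r / 2" for r
  have dF: "(F has_real_derivative source lam v r / 2) (at r within {0<..1})" if "r \<in> {0<..1}" for r
    unfolding F_def using that
    by (auto intro!: derivative_eq_intros B simp: field_simps power2_eq_square)
  have "((\<lambda>r. v r - r / 2 * (r * q r)) \<longlongrightarrow> 0 - 0 / 2 * 0) (at_right 0)"
    by (intro tendsto_intros B lim) auto
  then have F0: "(F \<longlongrightarrow> 0) (at_right 0)"
    unfolding F_def by (simp add: power2_eq_square mult.assoc)
  have Fpos: "0 \<le> F r" if "r \<in> {0<..1}" for r
    by (rule nonneg_derivative_imp_nonneg[OF dF _ F0 that]) (use src in auto)
  define A where "A = v 1"
  have A: "0 \<le> A" unfolding A_def by (rule boundary_pair_nonneg(2)[OF bp src]) auto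
  have conc: "A * r\<^sup>2 \<le> v r" if r: "r \<in> {0<..1}" for r
  proof -
    have "- (v r / r\<^sup>2) \<le> - (v 1 / 1\<^sup>2)"
    proof (rule nonneg_derivative_imp_mono[where b=1 and f="\<lambda>r. - (v r / r\<^sup>2)" and f'="\<lambda>r. 2 * F r / r ^ 3"])
      show "((\<lambda>r. - (v r / r\<^sup>2)) has_real_derivative 2 * F x / x ^ 3) (at x within {0<..1})"
        if "x \<in> {0<..1}" for x
        using that by (auto intro!: derivative_eq_intros B simp: F_def field_simps power_numeral_reduce)
    qed (use r Fpos in auto)
    then show ?thesis using r by (simp add: A_def field_simps)
  qed
  have "0 \<le> F 1 - (lam + A\<^sup>2) / 16 * 1 ^ 4"
  proof (rule nonneg_derivative_imp_nonneg[where b=1 and f="\<lambda>r. F r - (lam + A\<^sup>2) / 16 * r ^ 4"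
        and f'="\<lambda>r. source lam v r / 2 - (lam + A\<^sup>2) / 4 * r ^ 3"])
    show "((\<lambda>r. F r - (lam + A\<^sup>2) / 16 * r ^ 4) has_real_derivative
        source lam v x / 2 - (lam + A\<^sup>2) / 4 * x ^ 3) (at x within {0<..1})" if "x \<in> {0<..1}" for x
      using that by (auto intro!: derivative_eq_intros dF)
    show "((\<lambda>r. F r - (lam + A\<^sup>2) / 16 * r ^ 4) \<longlongrightarrow> 0) (at_right 0)"
      by (auto intro!: tendsto_eq_intros F0)
    show "0 \<le> source lam v x / 2 - (lam + A\<^sup>2) / 4 * x ^ 3" if x: "x \<in> {0<..1}" for x
    proof -
      have "(A * x\<^sup>2)\<^sup>2 / (4 * x) \<le> (v x)\<^sup>2 / (4 * x)"
        using conc[OF x] A x by (intro divide_right_mono power_mono) auto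
      moreover have "(A * x\<^sup>2)\<^sup>2 / (4 * x) = A\<^sup>2 / 4 * x ^ 3"
        using x by (simp add: field_simps power_numeral_reduce)
      ultimately show ?thesis by (simp add: source_def algebra_simps)
    qed
  qed auto
  then have "lam \<le> 8 * A - A\<^sup>2" using B(4) by (simp add: F_def A_def)
  also have "\<dots> \<le> 16" using zero_le_power2[of "A - 4"] by (simp add: power2_eq_square algebra_simps)
  finally show ?thesis .
qed

lemma N_solvable_iff:
  assumes "0 \<le> lam"
  shows "(\<exists>w. N_solution lam w) \<longleftrightarrow> (\<exists>v q. decaying_solution lam v q)"
  using N_solution_imp_decaying_solution[OF assms] decaying_solution_imp_N_solution by blast

theorem theorem4p2:
  "(\<exists>lam0::real. lam0 > 0 \<and>
      (\<forall>lam. 0 \<le> lam \<and> lam < lam0 \<longrightarrow> (\<exists>w. N_solution lam w)) \<and>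
      (\<forall>lam. lam > lam0 \<longrightarrow> \<not> (\<exists>w. N_solution lam w))) \<and>
   (\<forall>lam w. lam \<ge> 0 \<and> N_solution lam w \<longrightarrow>
      (\<forall>r\<in>{0<..1}. w r \<le> 0) \<and> (w \<longlongrightarrow> 0) (at_right 0))"
proof (intro conjI allI impI)
  define S where "S = {lam. 0 \<le> lam \<and> (\<exists>v q. decaying_solution lam v q)}"
  have one: "1 \<in> S" using decaying_solution_exists_one by (simp add: S_def)
  have bdd: "bdd_above S"
    using decaying_solution_parameter_bound by (auto simp: S_def intro!: bdd_aboveI[of _ 16])
  have Sup: "1 \<le> Sup S" by (rule cSup_upper[OF one bdd])
  show "\<exists>lam0::real. lam0 > 0 \<and>
      (\<forall>lam. 0 \<le> lam \<and> lam < lam0 \<longrightarrow> (\<exists>w. N_solution lam w)) \<and>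
      (\<forall>lam. lam > lam0 \<longrightarrow> \<not> (\<exists>w. N_solution lam w))"
  proof (intro exI[of _ "Sup S"] conjI allI impI)
    fix lam assume lam: "0 \<le> lam \<and> lam < Sup S"
    then obtain mu where "mu \<in> S" "lam < mu"
      using less_cSup_iff[OF _ bdd, of lam] one by blast
    then have "\<exists>v q. decaying_solution lam v q"
      using lam decaying_solution_smaller_parameter[of lam mu] by (auto simp: S_def)
    then show "\<exists>w. N_solution lam w" using N_solvable_iff lam by blast
  next
    fix lam assume lam: "lam > Sup S"
    then have "0 \<le> lam" "lam \<notin> S" using Sup cSup_upper[OF _ bdd, of lam] by auto
    then show "\<not> (\<exists>w. N_solution lam w)" using N_solvable_iff[of lam] by (simp add: S_def)
  qed (use Sup in auto)
next
  fix lam w assume lam: "0 \<le> lam \<and> N_solution lam w"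
  then obtain q where "decaying_solution lam (\<lambda>r. - w r) q"
    using N_solution_imp_decaying_solution by blast
  then have bp: "boundary_pair (source lam (\<lambda>r. - w r)) (\<lambda>r. - w r) q"
    by (simp add: decaying_solution_def)
  show "\<forall>r\<in>{0<..1}. w r \<le> 0"
    using boundary_pair_nonneg(2)[OF bp] source_nonneg lam by force
  show "(w \<longlongrightarrow> 0) (at_right 0)"
    using tendsto_minus[OF boundary_pairD(3)[OF bp]] by simp
qed

end
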